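(* Let $p$ be a prime such that $p=1+108t^2$ for some integer $t$. Then there exists a $\left(p,2,\frac{p-1}{6},\frac{p-1}{36}\right)$-SEDF.
   Context: Let $G$ be a finite abelian group of order $n$, written multiplicatively, with identity $e$. For nonempty subsets $A_1,A_2\subseteq G$, let $\Delta_E(A_1,A_2)$ be the multiset $\{xy^{-1} : x\in A_1,\ y\in A_2\}$. Let $k,\lambda,m$ be positive integers. An $(n,m,k,\lambda)$-strong external difference family (SEDF) over $G$ is a collection $\{A_1,\dots,A_m\}$ of pairwise disjoint $k$-element subsets of $G$ such that for each $1\le j\le m$ the multiset union $\bigcup_{\ell\neq j}\Delta_E(A_\ell,A_j)$ equals $\lambda(G\setminus\{e\})$, i.e. contains every non-identity element of $G$ exactly $\lambda$ times and does not contain $e$. "There exists an $(n,m,k,\lambda)$-SEDF" means that one exists over some finite abelian group of order $n$. *)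

theory Defs
  imports "HOL-Algebra.Group" "HOL-Algebra.Coset" "HOL-Library.Multiset"
    "HOL-Computational_Algebra.Primes"
begin

definition ext_diff :: "('a, 'b) monoid_scheme \<Rightarrow> 'a set \<Rightarrow> 'a set \<Rightarrow> 'a multiset" where
  "ext_diff G A B = image_mset (\<lambda>(x, y). x \<otimes>\<^bsub>G\<^esub> inv\<^bsub>G\<^esub> y) (mset_set (A \<times> B))"

text \<open>The collection of sets is represented as a family indexed by 1, ..., m; only the values
  on these indices matter. Since k is positive, the sets are nonempty, and pairwise disjointness
  makes the family injective, so it is the same as an (unordered) collection of m sets.\<close>

definition is_SEDF ::
  "('a, 'b) monoid_scheme \<Rightarrow> nat \<Rightarrow> nat \<Rightarrow> nat \<Rightarrow> nat \<Rightarrow> (nat \<Rightarrow> 'a set) \<Rightarrow> bool" where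
  "is_SEDF G n m k l A \<longleftrightarrow>
     comm_group G \<and> finite (carrier G) \<and> order G = n \<and>
     m > 0 \<and> k > 0 \<and> l > 0 \<and>
     (\<forall>j\<in>{1..m}. A j \<subseteq> carrier G \<and> card (A j) = k) \<and>
     (\<forall>i\<in>{1..m}. \<forall>j\<in>{1..m}. i \<noteq> j \<longrightarrow> A i \<inter> A j = {}) \<and>
     (\<forall>j\<in>{1..m}. (\<Sum>i\<in>{1..m} - {j}. ext_diff G (A i) (A j)) =
        repeat_mset l (mset_set (carrier G - {\<one>\<^bsub>G\<^esub>})))"

text \<open>HOL cannot quantify existentially over types. Taking the elements of the group to be natural
  numbers is no restriction, since every finite group is isomorphic to one whose carrier is a set
  of natural numbers.\<close>

definition SEDF_exists :: "nat \<Rightarrow> nat \<Rightarrow> nat \<Rightarrow> nat \<Rightarrow> bool" where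
  "SEDF_exists n m k l \<longleftrightarrow> (\<exists>(G :: nat monoid) A. is_SEDF G n m k l A)"

end

(*
  Let F be the field with p elements and chi its quadratic character. The two sets are the sextic
  residues and the cubes that are not squares. Writing c(x) for the number of cube roots of x,
  their indicator functions at x \<noteq> 0 are c(x) (1 + chi x) / 6 and c(x) (1 - chi x) / 6, so, as
  -1 is a sextic residue, 36 times the number of representations of d \<noteq> 0 as a difference is the
  sum of c(a) c(b) (1 - chi(a b)) over a + b = d with a, b \<noteq> 0. The pointwise identity
    c(a) c(b) = c(a) + c(b) + c(a b) + c(a / b) - 3
  expresses this through the sums S(D) of chi(x^3 + D) over x, namely as
    p + 1 + S(16 d^2) - 2 S(d^2) - S(4 d^4) - 2 c(d).
  On squares D, S takes three values, one for each cubic class. Their sum is 0, the sum of their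
  squares is 6 p, and congruences modulo 2 and 3 give S(1) = 2 a and -a + 3 b, -a - 3 b for the
  other two, with p = a^2 + 3 b^2 and a = -1 modulo 3. As p = 1 + 3 (6 t)^2 is the only such
  representation of the prime p, a = -1 and b = 6 t up to sign. The sum of c(a) c(b) over
  a + b = 1 is divisible by 9, which then forces 2 to be a cube. Hence S(16 d^2) = S(d^2) and
  S(4 d^4) = S(d^4), and the count is p - 1 for every d.
*)

theory Submission
  imports Defs "Berlekamp_Zassenhaus.Finite_Field" "HOL-Number_Theory.Residue_Primitive_Roots"
begin

section \<open>Difference families from pairs of sets in additive groups\<close>

lemma image_mset_differences:
  fixes A B :: "'a::{ab_group_add,finite} set"
  assumes "A \<inter> B = {}"
    and "\<And>d. d \<noteq> 0 \<Longrightarrow> card {(x, y) \<in> A \<times> B. x - y = d} = l"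
  shows "image_mset (\<lambda>(x, y). x - y) (mset_set (A \<times> B)) = repeat_mset l (mset_set (- {0}))"
proof (rule multiset_eqI)
  fix d
  have "{(x, y) \<in> A \<times> B. x - y = d} = (\<lambda>(x, y). x - y) -` {d} \<inter> A \<times> B"
    by auto
  then have "count (image_mset (\<lambda>(x, y). x - y) (mset_set (A \<times> B))) d =
      card {(x, y) \<in> A \<times> B. x - y = d}"
    by (simp add: count_image_mset)
  moreover have "{(x, y) \<in> A \<times> B. x - y = 0} = {}"
    using assms(1) by auto
  then have "card {(x, y) \<in> A \<times> B. x - y = 0} = 0"
    by (simp only: card.empty)
  ultimately show "count (image_mset (\<lambda>(x, y). x - y) (mset_set (A \<times> B))) d =
      count (repeat_mset l (mset_set (- {0}))) d"
    using assms(2)[of d] by (cases "d = 0") (simp_all add: count_mset_set')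
qed

text \<open>Transport of structure: the additive group is copied to \<open>{0..<n}\<close> along a
  bijection, because \<open>SEDF_exists\<close> asks for a carrier of natural numbers. One order of
  the two sets suffices, since negating \<open>d\<close> exchanges them.\<close>

lemma SEDF_exists_pair:
  fixes A B :: "'a::{ab_group_add,finite} set"
  assumes pos: "k > 0" "l > 0"
    and card: "card A = k" "card B = k"
    and disjoint: "A \<inter> B = {}"
    and differences: "\<And>d. d \<noteq> 0 \<Longrightarrow> card {(x, y) \<in> A \<times> B. x - y = d} = l"
  shows "SEDF_exists CARD('a) 2 k l"
proof -
  define n where "n = CARD('a)"
  obtain h :: "nat \<Rightarrow> 'a" where h: "bij_betw h {0..<n} UNIV"
    using ex_bij_betw_nat_finite[of "UNIV :: 'a set"] by (auto simp: n_def)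
  define r where "r = the_inv_into {0..<n} h"
  have bij_r: "bij_betw r UNIV {0..<n}"
    unfolding r_def using h by (rule bij_betw_the_inv_into)
  have hr [simp]: "h (r x) = x" for x
    unfolding r_def using f_the_inv_into_f_bij_betw[OF h] by simp
  have rh: "r (h i) = i" if "i < n" for i
    unfolding r_def using h that by (simp add: the_inv_into_f_f bij_betw_def)
  have r_less: "r x < n" for x
    using bij_betwE[OF bij_r] by simp
  have inj_r: "inj_on r S" for S
    using bij_betw_imp_inj_on[OF bij_r] by (rule inj_on_subset) simp
  define G :: "nat monoid" where
    "G = \<lparr>carrier = {0..<n}, monoid.mult = \<lambda>i j. r (h i + h j), one = r 0\<rparr>"
  have carrier: "carrier G = {0..<n}" and one: "\<one>\<^bsub>G\<^esub> = r 0"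
    and mult: "i \<otimes>\<^bsub>G\<^esub> j = r (h i + h j)" for i j
    by (simp_all add: G_def)
  have group: "comm_group G"
  proof (rule comm_groupI)
    fix i
    assume "i \<in> carrier G"
    show "\<exists>j\<in>carrier G. j \<otimes>\<^bsub>G\<^esub> i = \<one>\<^bsub>G\<^esub>"
      by (rule bexI[of _ "r (- h i)"]) (simp_all add: carrier mult one r_less)
  qed (simp_all add: carrier mult one r_less rh add_ac)
  interpret comm_group G
    by (rule group)
  have inv: "inv\<^bsub>G\<^esub> (r y) = r (- y)" for y
    by (rule inv_equality) (simp_all add: carrier mult one r_less)
  have range_r: "r ` UNIV = {0..<n}"
    using bij_r by (simp add: bij_betw_def)
  have ext_diff: "ext_diff G (r ` S) (r ` T) = repeat_mset l (mset_set (carrier G - {\<one>\<^bsub>G\<^esub>}))"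
    if "S \<inter> T = {}" "\<And>d. d \<noteq> 0 \<Longrightarrow> card {(x, y) \<in> S \<times> T. x - y = d} = l" for S T
  proof -
    have "mset_set (r ` S \<times> r ` T) = mset_set (map_prod r r ` (S \<times> T))"
      by (simp add: map_prod_surj_on[OF refl refl])
    also have "\<dots> = image_mset (map_prod r r) (mset_set (S \<times> T))"
      using inj_r by (intro image_mset_mset_set[symmetric] map_prod_inj_on)
    finally have "ext_diff G (r ` S) (r ` T) = image_mset (\<lambda>(x, y). r (x - y)) (mset_set (S \<times> T))"
      by (simp add: ext_diff_def image_mset.compositionality comp_def case_prod_unfold mult inv)
    also have "\<dots> = image_mset r (image_mset (\<lambda>(x, y). x - y) (mset_set (S \<times> T)))"
      by (simp add: image_mset.compositionality comp_def case_prod_unfold)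
    also have "image_mset (\<lambda>(x, y). x - y) (mset_set (S \<times> T)) = repeat_mset l (mset_set (- {0}))"
      using that by (rule image_mset_differences)
    also have "image_mset r (repeat_mset l M) = repeat_mset l (image_mset r M)" for M
      by (induction l) simp_all
    also have "image_mset r (mset_set (- {0})) = mset_set (r ` (- {0}))"
      using inj_r by (rule image_mset_mset_set)
    also have "r ` (- {0}) = carrier G - {\<one>\<^bsub>G\<^esub>}"
      unfolding carrier one Compl_eq_Diff_UNIV
      using inj_on_image_set_diff[OF inj_r[of UNIV], of UNIV "{0}"] range_r by simp
    finally show ?thesis .
  qed
  define F where "F j = r ` (if j = 1 then A else B)" for j :: nat
  have differences': "card {(x, y) \<in> B \<times> A. x - y = d} = l" if "d \<noteq> 0" for d
  proof -
    have "x - y = - d \<longleftrightarrow> y - x = d" for x y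
      by (metis minus_diff_eq minus_minus)
    then have "{(x, y) \<in> B \<times> A. x - y = d} = prod.swap ` {(x, y) \<in> A \<times> B. x - y = - d}"
      by (auto simp: image_iff)
    then have "card {(x, y) \<in> B \<times> A. x - y = d} = card {(x, y) \<in> A \<times> B. x - y = - d}"
      by (simp only: card_image[OF inj_on_subset[OF inj_swap subset_UNIV]])
    then show ?thesis
      using differences[of "- d"] that by simp
  qed
  have two: "{1..2} = {1, 2::nat}"
    by auto
  have "is_SEDF G n 2 k l F"
    unfolding is_SEDF_def two
  proof (intro conjI)
    show "Coset.order G = n"
      by (simp add: Coset.order_def carrier)
    show "\<forall>j\<in>{1, 2}. F j \<subseteq> carrier G \<and> card (F j) = k"
      using card card_image[OF inj_r] by (auto simp: F_def carrier r_less)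
    show "\<forall>i\<in>{1, 2}. \<forall>j\<in>{1, 2}. i \<noteq> j \<longrightarrow> F i \<inter> F j = {}"
      using disjoint inj_on_image_Int[OF inj_r[of UNIV], of A B] by (auto simp: F_def Int_commute)
    have "{1, 2} - {1} = {2::nat}" "{1, 2} - {2} = {1::nat}"
      by auto
    then show "\<forall>j\<in>{1, 2}. (\<Sum>i\<in>{1, 2} - {j}. ext_diff G (F i) (F j)) =
        repeat_mset l (mset_set (carrier G - {\<one>\<^bsub>G\<^esub>}))"
      using ext_diff[of A B] ext_diff[of B A] disjoint differences differences'
      by (auto simp: F_def Int_commute)
  qed (use group pos in \<open>simp_all add: carrier\<close>)
  then show ?thesis
    unfolding SEDF_exists_def n_def by blast
qed

section \<open>Sums over finite fields\<close>

lemma sum_scale: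
  fixes a :: "'a::{field,finite}"
  assumes "a \<noteq> 0"
  shows "(\<Sum>x\<in>UNIV. f (a * x)) = (\<Sum>x\<in>UNIV. f x)"
  using assms by (intro sum.reindex_bij_witness[of _ "\<lambda>x. x / a" "\<lambda>x. a * x"]) auto

lemma sum_scale_nonzero:
  fixes a :: "'a::{field,finite}"
  assumes "a \<noteq> 0"
  shows "(\<Sum>x\<in>- {0}. f (a * x)) = (\<Sum>x\<in>- {0}. f x)"
  using assms by (intro sum.reindex_bij_witness[of _ "\<lambda>x. x / a" "\<lambda>x. a * x"]) auto

lemma sum_shift:
  fixes b :: "'a::{field,finite}"
  shows "(\<Sum>x\<in>UNIV. f (x + b)) = (\<Sum>x\<in>UNIV. f x)"
  by (intro sum.reindex_bij_witness[of _ "\<lambda>x. x - b" "\<lambda>x. x + b"]) auto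

lemma sum_inverse:
  fixes f :: "'a::{field,finite} \<Rightarrow> _"
  shows "(\<Sum>x\<in>- {0}. f (inverse x)) = (\<Sum>x\<in>- {0}. f x)"
  by (intro sum.reindex_bij_witness[of _ inverse inverse]) auto

lemma sum_fibre:
  fixes h :: "'b \<Rightarrow> 'a::finite" and f :: "'a \<Rightarrow> int"
  assumes "finite A"
  shows "(\<Sum>u\<in>A. f (h u)) = (\<Sum>x\<in>UNIV. int (card {u\<in>A. h u = x}) * f x)"
proof -
  have "(\<Sum>u\<in>A. f (h u)) = (\<Sum>x\<in>UNIV. \<Sum>u\<in>{u\<in>A. h u = x}. f (h u))"
    using assms by (intro sum.group[symmetric]) auto
  also have "\<dots> = (\<Sum>x\<in>UNIV. int (card {u\<in>A. h u = x}) * f x)"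
    by (intro sum.cong) auto
  finally show ?thesis .
qed

lemma sum_periodic:
  fixes f :: "nat \<Rightarrow> int"
  assumes "\<And>k. f (k + n) = f k"
  shows "(\<Sum>k<n * m. f k) = int m * (\<Sum>k<n. f k)"
proof -
  have *: "f (k + i * n) = f k" for k i
    by (induction i) (use assms[of "k + i * n" for i] in \<open>simp_all add: algebra_simps\<close>)
  have "sum f {i * n..<i * n + n} = (\<Sum>k<n. f (k + i * n))" for i
    by (intro sum.reindex_bij_witness[of _ "\<lambda>k. k + i * n" "\<lambda>k. k - i * n"]) auto
  then have "sum f {i * n..<i * n + n} = (\<Sum>k<n. f k)" for i
    unfolding * .
  then show ?thesis
    using sum.nat_group[of f n m] by (simp add: mult.commute)
qed

section \<open>Uniqueness of representations by the form a^2 + 3 b^2\<close>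

text \<open>The composition identity \<open>sq\<close> bounds \<open>a * d - b * c\<close>: a
  nonzero multiple of \<open>p\<close> would make its right side at least \<open>3 * p ^ 2\<close>.
  Hence \<open>a * d = b * c\<close>, which forces \<open>d ^ 2 = b ^ 2\<close>.\<close>

lemma norm_form_unique_aux:
  fixes a b c d p :: int
  assumes "p > 0" "p = a ^ 2 + 3 * b ^ 2" "p = c ^ 2 + 3 * d ^ 2" "p dvd a * d - b * c"
  shows "a ^ 2 = c ^ 2"
proof -
  have sq: "p ^ 2 = (a * c + 3 * b * d) ^ 2 + 3 * (a * d - b * c) ^ 2"
  proof -
    have "p ^ 2 = (a ^ 2 + 3 * b ^ 2) * (c ^ 2 + 3 * d ^ 2)"
      using assms(2,3) by (simp add: power2_eq_square)
    then show ?thesis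
      by (simp add: algebra_simps power2_eq_square)
  qed
  have "a * d - b * c = 0"
  proof (rule ccontr)
    assume "a * d - b * c \<noteq> 0"
    then have "p \<le> \<bar>a * d - b * c\<bar>"
      using assms(1,4) zdvd_imp_le[of p "\<bar>a * d - b * c\<bar>"] by simp
    then have "p ^ 2 \<le> (a * d - b * c) ^ 2"
      using assms(1) by (simp add: abs_le_square_iff[symmetric])
    moreover have "p ^ 2 > 0" "(a * c + 3 * b * d) ^ 2 \<ge> 0"
      using assms(1) by simp_all
    ultimately show False
      using sq by linarith
  qed
  moreover have "p * (d ^ 2 - b ^ 2) = (a * d - b * c) * (a * d + b * c)"
  proof -
    have "p * (d ^ 2 - b ^ 2) = (a ^ 2 + 3 * b ^ 2) * d ^ 2 - b ^ 2 * (c ^ 2 + 3 * d ^ 2)"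
      using assms(2,3) by (simp add: algebra_simps)
    then show ?thesis
      by (simp add: algebra_simps power2_eq_square)
  qed
  ultimately have "d ^ 2 = b ^ 2"
    using assms(1) by simp
  then show ?thesis
    using assms(2,3) by simp
qed

text \<open>The product of \<open>a * d - b * c\<close> and \<open>a * d + b * c\<close> is a
  multiple of the prime \<open>p\<close>, so \<open>p\<close> divides one factor. Changing the sign
  of \<open>b\<close> turns the second case into the first.\<close>

lemma norm_form_unique:
  fixes a b c d p :: int
  assumes "prime p" "p = a ^ 2 + 3 * b ^ 2" "p = c ^ 2 + 3 * d ^ 2"
  shows "a ^ 2 = c ^ 2"
proof -
  have "(a * d - b * c) * (a * d - (- b) * c) =
      (a ^ 2 + 3 * b ^ 2) * d ^ 2 - b ^ 2 * (c ^ 2 + 3 * d ^ 2)"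
    by (simp add: algebra_simps power2_eq_square)
  also have "\<dots> = p * (d ^ 2 - b ^ 2)"
    using assms(2,3) by (simp add: algebra_simps)
  finally have "p dvd (a * d - b * c) * (a * d - (- b) * c)"
    by simp
  then have "p dvd a * d - b * c \<or> p dvd a * d - (- b) * c"
    using assms(1) prime_dvd_mult_iff by blast
  then show ?thesis
    using norm_form_unique_aux[of p a b c d] norm_form_unique_aux[of p a "- b" c d] assms
      prime_gt_0_int[OF assms(1)] by auto
qed

section \<open>Quadratic and cubic residues\<close>

text \<open>Divisibility of the group order by 12 makes exponents of \<open>g\<close> well defined
  modulo 2, 3 and 6, and puts \<open>-1 = g ^ (N div 2)\<close> among the sixth powers.\<close>

locale cyclic_field =
  fixes g :: "'a::{field,finite}" and N :: nat
  assumes card_field: "CARD('a) = N + 1"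
    and bij_power: "bij_betw (\<lambda>i. g ^ i) {..<N} (- {0})"
    and twelve_dvd_order: "12 dvd N"
begin

text \<open>The discrete logarithm to the base \<open>g\<close>. Its value at 0 is unspecified, so
  every use is confined to nonzero elements.\<close>

definition ind :: "'a \<Rightarrow> nat" where
  "ind x = the_inv_into {..<N} (\<lambda>i. g ^ i) x"

lemma N_gt_1: "N > 1"
proof -
  have "card {0, 1::'a} \<le> CARD('a)"
    by (intro card_mono) auto
  then have "N \<noteq> 0"
    by (simp add: card_field)
  with twelve_dvd_order show ?thesis
    by presburger
qed

lemma ind_less: "x \<noteq> 0 \<Longrightarrow> ind x < N"
  using the_inv_into_into[of "\<lambda>i. g ^ i" "{..<N}" x "{..<N}"] bij_power
  by (auto simp: bij_betw_def ind_def)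

lemma power_ind: "x \<noteq> 0 \<Longrightarrow> g ^ ind x = x"
  using f_the_inv_into_f_bij_betw[OF bij_power, of x] by (simp add: ind_def)

lemma generator_nonzero: "g \<noteq> 0"
proof -
  have "g ^ 1 \<in> - {0}"
    using N_gt_1 by (intro bij_betwE[OF bij_power, rule_format]) auto
  then show ?thesis by simp
qed

text \<open>The powers below \<open>N\<close> exhaust the nonzero elements, so
  \<open>g ^ N = g ^ j\<close> for some \<open>j < N\<close>. Cancelling gives
  \<open>g ^ (N - j) = 1\<close>, which for \<open>j > 0\<close> contradicts injectivity.\<close>

lemma power_order: "g ^ N = 1"
proof -
  define j where "j = ind (g ^ N)"
  have j: "g ^ j = g ^ N" "j < N"
    using power_ind[of "g ^ N"] ind_less[of "g ^ N"] generator_nonzero by (auto simp: j_def)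
  have "g ^ j * g ^ (N - j) = g ^ N"
    using j(2) by (simp flip: power_add)
  then have "g ^ j * g ^ (N - j) = g ^ j"
    using j(1) by simp
  then have *: "g ^ (N - j) = g ^ 0"
    using generator_nonzero by simp
  have "j = 0"
  proof (rule ccontr)
    assume "j \<noteq> 0"
    then have "N - j \<in> {..<N}" "0 \<in> {..<N}"
      using j(2) by auto
    then have "N - j = 0"
      using bij_betw_imp_inj_on[OF bij_power] * by (meson inj_onD)
    then show False
      using j(2) by simp
  qed
  then show ?thesis
    using j(1) by simp
qed

lemma power_mod_order: "g ^ (i mod N) = g ^ i"
proof -
  have "g ^ i = g ^ (N * (i div N) + i mod N)"
    by simp
  also have "\<dots> = g ^ (i mod N)"
    unfolding power_add power_mult power_order by simp
  finally show ?thesis ..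
qed

lemma ind_power: "ind (g ^ i) = i mod N"
proof -
  have "ind (g ^ (i mod N)) = i mod N"
    unfolding ind_def
    using N_gt_1 by (intro the_inv_into_f_f bij_betw_imp_inj_on[OF bij_power]) auto
  then show ?thesis
    by (simp add: power_mod_order)
qed

lemma ind_power_mod: "d dvd 12 \<Longrightarrow> ind (g ^ i) mod d = i mod d"
  unfolding ind_power
  by (rule mod_mod_cancel) (rule dvd_trans[OF _ twelve_dvd_order])

lemma ind_mult_mod:
  assumes "x \<noteq> 0" "y \<noteq> 0" "d dvd 12"
  shows "ind (x * y) mod d = (ind x + ind y) mod d"
proof -
  have "x * y = g ^ (ind x + ind y)"
    using assms by (simp add: power_add power_ind)
  then show ?thesis
    using ind_power_mod[OF assms(3)] by simp
qed

lemma minus_one_eq_power: "g ^ (N div 2) = -1"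
proof -
  let ?h = "g ^ (N div 2)"
  have "N div 2 * 2 = N"
    using twelve_dvd_order by presburger
  then have "?h ^ 2 = 1"
    using power_order by (simp flip: power_mult)
  moreover have "?h \<noteq> 1"
  proof
    assume "?h = 1"
    then have "ind ?h = ind (g ^ 0)"
      by simp
    then have "N div 2 mod N = 0"
      unfolding ind_power by simp
    then show False
      using N_gt_1 twelve_dvd_order by (subst (asm) mod_less) auto
  qed
  ultimately show ?thesis
    by (simp add: power2_eq_1_iff)
qed

lemma ind_minus_one: "ind (- 1) mod 6 = 0"
proof -
  have "ind (- 1) mod 6 = N div 2 mod 6"
    using ind_power_mod[of 6 "N div 2"] by (simp add: minus_one_eq_power)
  then show ?thesis
    using twelve_dvd_order by presburger
qed

lemma two_nonzero: "(2::'a) \<noteq> 0"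
proof
  assume "(2::'a) = 0"
  then have "(-1::'a) = 1"
    by (metis add_eq_0_iff one_add_one)
  then have "ind (g ^ (N div 2)) = ind (g ^ 0)"
    by (simp only: minus_one_eq_power power_0)
  then have "N div 2 mod N = 0"
    unfolding ind_power by simp
  then show False
    using N_gt_1 twelve_dvd_order by (subst (asm) mod_less) auto
qed

lemma four_nonzero: "(4::'a) \<noteq> 0"
  using two_nonzero by (metis mult_2 mult_eq_0_iff numeral_Bit0)

section \<open>Quadratic character and numbers of cube roots\<close>

definition chi :: "'a \<Rightarrow> int" where
  "chi x = (if x = 0 then 0 else (- 1) ^ ind x)"

text \<open>For a cubic character psi with psi(0) = 0 this is 1 + psi(x) + psi(x)^2. Counting roots
  keeps all sums in the integers.\<close>

definition cbrts :: "'a \<Rightarrow> int" where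
  "cbrts x = int (card {u. u ^ 3 = x})"

lemma minus_one_power_mod_2: "(- 1 :: int) ^ n = (if n mod 2 = 0 then 1 else -1)"
  by (auto simp: even_iff_mod_2_eq_zero uminus_power_if)

lemma chi_0 [simp]: "chi 0 = 0"
  by (simp add: chi_def)

lemma chi_power: "chi (g ^ i) = (- 1) ^ i"
  using ind_power_mod[of 2 i] generator_nonzero by (simp add: chi_def minus_one_power_mod_2)

lemma chi_1 [simp]: "chi 1 = 1"
  using chi_power[of 0] by simp

lemma chi_mult: "chi (x * y) = chi x * chi y"
proof (cases "x = 0 \<or> y = 0")
  case False
  then have "chi (x * y) = chi (g ^ (ind x + ind y))"
    by (simp add: power_add power_ind)
  then show ?thesis
    unfolding chi_power using False by (simp add: chi_def power_add)
qed auto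

lemma chi_powers: "chi (x ^ n) = chi x ^ n"
  by (induction n) (simp_all add: chi_mult)

lemma chi_minus [simp]: "chi (- x) = chi x"
proof -
  have "ind (- 1) mod 2 = 0"
    using ind_minus_one by presburger
  then have "chi (- 1) = 1"
    by (simp add: chi_def minus_one_power_mod_2)
  then show ?thesis
    using chi_mult[of "-1" x] by simp
qed

lemma chi_cases: "x \<noteq> 0 \<Longrightarrow> chi x = 1 \<or> chi x = -1"
  by (simp add: chi_def minus_one_power_mod_2)

lemma chi_square: "chi x ^ 2 = (if x = 0 then 0 else 1)"
  using chi_cases[of x] by auto

lemma chi_square_mult: "y \<noteq> 0 \<Longrightarrow> chi (y ^ 2 * x) = chi x"
  by (simp add: chi_mult chi_powers chi_square)

lemma chi_cube: "chi (x ^ 3) = chi x"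
  using chi_cases[of x] by (cases "x = 0") (auto simp: chi_powers)

lemma card_square_roots: "int (card {y. y ^ 2 = x}) = 1 + chi x"
proof (cases "x = 0")
  case False
  show ?thesis
  proof (cases "even (ind x)")
    case True
    define y where "y = g ^ (ind x div 2)"
    have y: "x = y ^ 2"
      using True False power_ind[of x] by (simp add: y_def flip: power_mult)
    then have "y \<noteq> - y"
      using False two_nonzero by (metis add_eq_0_iff mult_2 mult_eq_0_iff zero_power2)
    moreover have "{z. z ^ 2 = x} = {y, - y}"
      unfolding y by (auto simp: power2_eq_iff)
    ultimately show ?thesis
      using True False by (simp add: chi_def)
  next
    case odd: False
    have "y ^ 2 \<noteq> x" for y
    proof
      assume y: "y ^ 2 = x"
      then have "chi x = chi y ^ 2"
        by (simp add: chi_powers flip: y)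
      then have "chi x = 1"
        using False y by (auto simp: chi_square)
      then show False
        using False odd by (auto simp: chi_def)
    qed
    then show ?thesis
      using False odd by (simp add: chi_def)
  qed
qed simp

lemma cbrts_0 [simp]: "cbrts 0 = 1"
  by (simp add: cbrts_def)

lemma cbrts_eq:
  assumes "x \<noteq> 0"
  shows "cbrts x = (if ind x mod 3 = 0 then 3 else 0)"
proof (cases "ind x mod 3 = 0")
  case True
  \<comment> \<open>A primitive cube root of unity: the cube roots of \<open>x\<close> will be
    \<open>y\<close>, \<open>w * y\<close> and \<open>w ^ 2 * y\<close>.\<close>
  define w where "w = g ^ (N div 3)"
  define y where "y = g ^ (ind x div 3)"
  have "ind x div 3 * 3 = ind x"
    using True by presburger
  then have y: "x = y ^ 3"
    using assms power_ind[of x] by (simp add: y_def flip: power_mult)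
  have "N div 3 * 3 = N"
    using twelve_dvd_order by presburger
  then have w3: "w ^ 3 = 1"
    using power_order by (simp add: w_def flip: power_mult)
  have w1: "w \<noteq> 1"
  proof
    assume "w = 1"
    then have "ind (g ^ (N div 3)) = ind (g ^ 0)"
      by (simp add: w_def)
    then have "N div 3 mod N = 0"
      unfolding ind_power by simp
    then show False
      using N_gt_1 twelve_dvd_order by (subst (asm) mod_less) auto
  qed
  have "(w - 1) * (w ^ 2 + w + 1) = 0"
    using w3 by (simp add: algebra_simps power2_eq_square power3_eq_cube)
  then have w2: "w ^ 2 + w + 1 = 0"
    using w1 by simp
  have y0: "y \<noteq> 0"
    using y assms by auto
  have "z ^ 3 = x \<longleftrightarrow> z = y \<or> z = w * y \<or> z = w ^ 2 * y" for z
  proof -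
    have "(z - w * y) * (z - w ^ 2 * y) = z ^ 2 - (w ^ 2 + w + 1) * z * y + z * y + w ^ 3 * y ^ 2"
      by (simp add: algebra_simps power2_eq_square power3_eq_cube)
    then have "z ^ 3 - y ^ 3 = (z - y) * ((z - w * y) * (z - w ^ 2 * y))"
      unfolding w2 w3 by (simp add: algebra_simps power2_eq_square power3_eq_cube)
    then show ?thesis
      unfolding y by (metis (no_types, lifting) diff_eq_diff_eq eq_iff_diff_eq_0 mult_eq_0_iff)
  qed
  then have "{z. z ^ 3 = x} = {y, w * y, w ^ 2 * y}"
    by auto
  moreover have "w ^ 2 \<noteq> 1"
    using w3 w1 by (metis mult_1 power2_eq_square power3_eq_cube)
  moreover have "w ^ 2 \<noteq> w"
    using w1 w3 by (auto simp: power2_eq_square)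
  ultimately show ?thesis
    using True y0 w1 by (auto simp: cbrts_def)
next
  case False
  have "y ^ 3 \<noteq> x" for y
  proof
    assume y: "y ^ 3 = x"
    then have "y \<noteq> 0"
      using assms by auto
    then have "x = g ^ (ind y * 3)"
      using y by (simp add: power_ind power_mult)
    then have "ind x mod 3 = ind y * 3 mod 3"
      using ind_power_mod[of 3 "ind y * 3"] by simp
    with False show False
      by simp
  qed
  then show ?thesis
    using False by (simp add: cbrts_def)
qed

lemma cbrts_minus: "cbrts (- x) = cbrts x"
proof (cases "x = 0")
  case False
  have "ind (- x) mod 3 = (ind (- 1) + ind x) mod 3"
    using ind_mult_mod[of "-1" x 3] False by simp
  also have "\<dots> = ind x mod 3"
    using ind_minus_one by presburger
  finally show ?thesis
    using False by (simp add: cbrts_eq)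
qed simp

lemma cbrts_minus_one: "cbrts (- 1) = 3"
  using cbrts_minus[of 1] ind_power_mod[of 3 0] by (simp add: cbrts_eq)

text \<open>Expanding the product of two factors 1 + psi + psi^2 for a cubic character psi leaves 1
  plus the nontrivial parts \<open>cbrts z - 1\<close> at \<open>a\<close>, \<open>b\<close>,
  \<open>a * b\<close> and \<open>a / b\<close>; the constant is 1 - 4. The proof compares indices
  modulo 3 instead.\<close>

lemma cbrts_mult:
  assumes "a \<noteq> 0" "b \<noteq> 0"
  shows "cbrts a * cbrts b = cbrts a + cbrts b + cbrts (a * b) + cbrts (a / b) - 3"
proof -
  have ab: "ind (a * b) mod 3 = (ind a + ind b) mod 3"
    using assms ind_mult_mod[of a b 3] by simp
  have "ind a mod 3 = (ind (a / b) + ind b) mod 3"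
    using assms ind_mult_mod[of "a / b" b 3] by simp
  then have "ind (a / b) mod 3 = 0 \<longleftrightarrow> ind a mod 3 = ind b mod 3"
    by presburger
  with ab show ?thesis
    using assms by (simp add: cbrts_eq) presburger
qed

section \<open>Character sums of cubics\<close>

lemma sum_nonzero_UNIV:
  fixes f :: "'a \<Rightarrow> int"
  shows "(\<Sum>x\<in>UNIV. f x) = f 0 + (\<Sum>x\<in>- {0}. f x)"
  by (simp add: Compl_eq_Diff_UNIV sum.remove[of UNIV 0])

lemma sum_cube:
  fixes f :: "'a \<Rightarrow> int"
  shows "(\<Sum>u\<in>UNIV. f (u ^ 3)) = (\<Sum>x\<in>UNIV. cbrts x * f x)"
  using sum_fibre[of UNIV f "\<lambda>u. u ^ 3"] by (simp add: cbrts_def)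

lemma card_nonzero: "card (- {0::'a}) = N"
  by (simp add: Compl_eq_Diff_UNIV card_field)

lemma sum_cbrts: "(\<Sum>x\<in>UNIV. cbrts x) = int N + 1"
  using sum_cube[of "\<lambda>_. 1"] by (simp add: card_field)

lemma sum_chi: "(\<Sum>x\<in>UNIV. chi x) = 0"
proof -
  have "(\<Sum>x\<in>UNIV. chi (g * x)) = (\<Sum>x\<in>UNIV. chi x)"
    using sum_scale[of g chi] generator_nonzero by simp
  then have "chi g * (\<Sum>x\<in>UNIV. chi x) = (\<Sum>x\<in>UNIV. chi x)"
    by (simp add: chi_mult sum_distrib_left)
  moreover have "chi g = -1"
    using chi_power[of 1] by simp
  ultimately show ?thesis
    by simp
qed

lemma sum_chi_nonzero: "(\<Sum>x\<in>- {0}. chi x) = 0"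
  using sum_chi sum_nonzero_UNIV[of chi] by simp

text \<open>After a shift the argument is \<open>x * (x + ?c)\<close>. Dividing it by the square
  \<open>x ^ 2\<close> and inverting \<open>x\<close> makes it linear; for \<open>?c\<close> nonzero
  the full linear sum vanishes, and its missing term at 0 accounts for -1.\<close>

lemma sum_chi_quadratic:
  "(\<Sum>x\<in>UNIV. chi ((x + a) * (x + b))) = (if a = b then int N else -1)"
proof -
  let ?c = "b - a"
  have "(\<Sum>x\<in>UNIV. chi ((x + a) * (x + b))) = (\<Sum>x\<in>UNIV. chi (x * (x + ?c)))"
    using sum_shift[of "\<lambda>x. chi (x * (x + ?c))" a] by (simp add: algebra_simps)
  also have "\<dots> = (\<Sum>x\<in>- {0}. chi (x * (x + ?c)))"
    using sum_nonzero_UNIV[of "\<lambda>x. chi (x * (x + ?c))"] by simp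
  also have "\<dots> = (\<Sum>x\<in>- {0}. chi (1 + ?c * inverse x))"
  proof (intro sum.cong refl)
    fix x :: 'a
    assume "x \<in> - {0}"
    then have "x ^ 2 * (1 + ?c * inverse x) = x * (x + ?c)" "x \<noteq> 0"
      by (auto simp: field_simps power2_eq_square)
    then show "chi (x * (x + ?c)) = chi (1 + ?c * inverse x)"
      by (metis chi_square_mult)
  qed
  also have "\<dots> = (\<Sum>x\<in>- {0}. chi (1 + ?c * x))"
    by (rule sum_inverse)
  also have "\<dots> = (if a = b then int N else -1)"
  proof (cases "a = b")
    case True
    then show ?thesis
      by (simp add: card_nonzero)
  next
    case False
    have "(\<Sum>x\<in>UNIV. chi (1 + ?c * x)) = (\<Sum>x\<in>UNIV. chi (1 + x))"
      using False sum_scale[of ?c "\<lambda>x. chi (1 + x)"] by simp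
    also have "\<dots> = 0"
      using sum_shift[of chi 1] sum_chi by (simp add: add.commute)
    finally show ?thesis
      using False sum_nonzero_UNIV[of "\<lambda>x. chi (1 + ?c * x)"] by simp
  qed
  finally show ?thesis .
qed

text \<open>The number of affine points on y^2 = x^3 + D, minus the field size. For nonzero
  \<open>D\<close> it is the negated trace of Frobenius of this elliptic curve.\<close>

definition cubic_sum :: "'a \<Rightarrow> int" where
  "cubic_sum D = (\<Sum>x\<in>UNIV. chi (x ^ 3 + D))"

text \<open>Substitute \<open>r * x\<close> for \<open>x\<close>. On nonzero arguments
  \<open>cubic_sum\<close> thus depends only on the class modulo sixth powers, and a factor
  \<open>g ^ 3\<close> flips its sign.\<close>

lemma cubic_sum_scale_cube:
  assumes "r \<noteq> 0"
  shows "cubic_sum (D * r ^ 3) = chi r * cubic_sum D"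
proof -
  have "cubic_sum (D * r ^ 3) = (\<Sum>x\<in>UNIV. chi ((r * x) ^ 3 + D * r ^ 3))"
    unfolding cubic_sum_def using sum_scale[OF assms, of "\<lambda>x. chi (x ^ 3 + D * r ^ 3)"] by simp
  also have "\<dots> = (\<Sum>x\<in>UNIV. chi (r ^ 3) * chi (x ^ 3 + D))"
    by (simp add: algebra_simps power_mult_distrib flip: chi_mult)
  also have "\<dots> = chi r * cubic_sum D"
    by (simp add: chi_cube cubic_sum_def sum_distrib_left)
  finally show ?thesis .
qed

lemma cubic_sum_minus: "cubic_sum (- D) = cubic_sum D"
  using cubic_sum_scale_cube[of "-1" D] by simp

lemma cubic_sum_0: "cubic_sum 0 = 0"
  by (simp add: cubic_sum_def chi_cube sum_chi)

text \<open>Invert \<open>z\<close> and multiply the argument by the square of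
  \<open>a * z ^ 2\<close>, which \<open>chi\<close> does not see; the result is a cubic in
  \<open>a * z\<close>. The excluded term at 0 is \<open>chi (a ^ 2 * b) = chi b\<close>.\<close>

lemma sum_chi_cube_twist:
  assumes "a \<noteq> 0"
  shows "(\<Sum>z\<in>- {0}. chi z * chi (a + b * z ^ 3)) = cubic_sum (a ^ 2 * b) - chi b"
proof -
  have "(\<Sum>z\<in>- {0}. chi z * chi (a + b * z ^ 3)) =
      (\<Sum>z\<in>- {0}. chi (inverse z) * chi (a + b * inverse z ^ 3))"
    using sum_inverse[of "\<lambda>z. chi z * chi (a + b * z ^ 3)"] by simp
  also have "\<dots> = (\<Sum>z\<in>- {0}. chi ((a * z) ^ 3 + a ^ 2 * b))"
  proof (intro sum.cong refl)
    fix z :: 'a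
    assume z: "z \<in> - {0}"
    have "(a * z ^ 2) ^ 2 * (inverse z * (a + b * inverse z ^ 3)) = (a * z) ^ 3 + a ^ 2 * b"
      using z by (simp add: field_simps power2_eq_square power3_eq_cube)
    moreover have "a * z ^ 2 \<noteq> 0"
      using z assms by simp
    ultimately show "chi (inverse z) * chi (a + b * inverse z ^ 3) = chi ((a * z) ^ 3 + a ^ 2 * b)"
      by (metis chi_mult chi_square_mult)
  qed
  also have "\<dots> = (\<Sum>z\<in>- {0}. chi (z ^ 3 + a ^ 2 * b))"
    using sum_scale_nonzero[OF assms, of "\<lambda>z. chi (z ^ 3 + a ^ 2 * b)"] .
  also have "\<dots> = cubic_sum (a ^ 2 * b) - chi b"
    using sum_nonzero_UNIV[of "\<lambda>z. chi (z ^ 3 + a ^ 2 * b)"] assms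
    by (simp add: cubic_sum_def chi_square_mult)
  finally show ?thesis .
qed

section \<open>Moments and congruences of the cubic sums\<close>

lemma sum_powers:
  fixes f :: "'a \<Rightarrow> int"
  shows "(\<Sum>x\<in>- {0}. f x) = (\<Sum>k<N. f (g ^ k))"
  using sum.reindex_bij_betw[OF bij_power, of f] by simp

lemma cubic_sum_power_add_3: "cubic_sum (g ^ (k + 3)) = - cubic_sum (g ^ k)"
  using cubic_sum_scale_cube[of g "g ^ k"] chi_power[of 1] generator_nonzero
  by (simp add: power_add)

lemma cubic_sum_power_add_6: "cubic_sum (g ^ (k + 6)) = cubic_sum (g ^ k)"
  using cubic_sum_power_add_3[of k] cubic_sum_power_add_3[of "k + 3"] by (simp add: add.assoc)

text \<open>Average \<open>chi D * cubic_sum D\<close> over all \<open>D\<close>; the inner sums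
  over \<open>D\<close> are quadratic. The weight \<open>chi D\<close> makes the classes of
  \<open>D\<close> and \<open>D * g ^ 3\<close> add up instead of cancelling, so each of the three
  values occurs twice per period.\<close>

lemma cubic_sum_first_moment: "cubic_sum 1 + cubic_sum (g ^ 2) + cubic_sum (g ^ 4) = 0"
proof -
  have "(\<Sum>D\<in>UNIV. chi D * cubic_sum D) = (\<Sum>x\<in>UNIV. \<Sum>D\<in>UNIV. chi ((D + 0) * (D + x ^ 3)))"
    unfolding cubic_sum_def sum_distrib_left
    by (subst sum.swap) (simp add: chi_mult add.commute)
  also have "\<dots> = (\<Sum>x\<in>UNIV. if x = (0::'a) then int N else -1)"
    unfolding sum_chi_quadratic by (intro sum.cong) auto
  also have "\<dots> = 0"
    unfolding sum_nonzero_UNIV by (simp add: card_nonzero)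
  finally have "0 = (\<Sum>D\<in>- {0}. chi D * cubic_sum D)"
    unfolding sum_nonzero_UNIV by simp
  also have "\<dots> = (\<Sum>k<6 * (N div 6). chi (g ^ k) * cubic_sum (g ^ k))"
    unfolding sum_powers using twelve_dvd_order by (intro sum.cong arg_cong[of _ _ lessThan]) presburger+
  also have "\<dots> = int (N div 6) * (\<Sum>k<6. chi (g ^ k) * cubic_sum (g ^ k))"
    by (rule sum_periodic) (simp add: cubic_sum_power_add_6 chi_power minus_one_power_iff)
  finally have "(\<Sum>k<6. chi (g ^ k) * cubic_sum (g ^ k)) = 0"
    using N_gt_1 twelve_dvd_order by simp presburger
  then show ?thesis
    using cubic_sum_power_add_3[of 0] cubic_sum_power_add_3[of 1] cubic_sum_power_add_3[of 2]
    by (simp add: chi_power eval_nat_numeral)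
qed

text \<open>Expanding the square and summing over \<open>D\<close> first leaves a count of the pairs
  with \<open>x ^ 3 = y ^ 3\<close>: three values of \<open>y\<close> for each nonzero
  \<open>x\<close>, and one for \<open>x = 0\<close>.\<close>

lemma cubic_sum_second_moment:
  "(cubic_sum 1) ^ 2 + (cubic_sum (g ^ 2)) ^ 2 + (cubic_sum (g ^ 4)) ^ 2 = 6 * (int N + 1)"
proof -
  have "(\<Sum>D\<in>UNIV. (cubic_sum D) ^ 2) =
      (\<Sum>D\<in>UNIV. \<Sum>x\<in>UNIV. \<Sum>y\<in>UNIV. chi ((D + x ^ 3) * (D + y ^ 3)))"
    unfolding cubic_sum_def power2_eq_square sum_product by (simp add: chi_mult add.commute)
  also have "\<dots> = (\<Sum>x\<in>UNIV. \<Sum>y\<in>UNIV. \<Sum>D\<in>UNIV. chi ((D + x ^ 3) * (D + y ^ 3)))"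
    by (subst sum.swap, rule sum.cong[OF refl], rule sum.swap)
  also have "\<dots> = (\<Sum>x\<in>UNIV. \<Sum>y\<in>UNIV. (int N + 1) * of_bool (y ^ 3 = (x::'a) ^ 3) - 1)"
    unfolding sum_chi_quadratic by (intro sum.cong) auto
  also have "\<dots> = (\<Sum>x\<in>UNIV. (int N + 1) * cbrts (x ^ 3) - (int N + 1))"
    by (simp add: sum_subtractf card_field cbrts_def flip: sum_distrib_left)
  also have "\<dots> = (int N + 1) * (\<Sum>x\<in>UNIV. cbrts (x ^ 3)) - (int N + 1) ^ 2"
    by (simp add: sum_subtractf card_field power2_eq_square flip: sum_distrib_left)
  also have "(\<Sum>x\<in>UNIV. cbrts (x ^ 3)) = 1 + (\<Sum>x\<in>- {0::'a}. 3)"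
    unfolding sum_nonzero_UNIV
  proof (intro arg_cong2[of _ _ _ _ "(+)"] sum.cong refl)
    fix x :: 'a
    assume "x \<in> - {0}"
    then have "x \<noteq> 0" by simp
    then have "x ^ 3 = g ^ (ind x * 3)"
      by (simp add: power_mult power_ind)
    then have "ind (x ^ 3) mod 3 = 0"
      using ind_power_mod[of 3 "ind x * 3"] by simp
    then show "cbrts (x ^ 3) = 3"
      using \<open>x \<noteq> 0\<close> by (simp add: cbrts_eq)
  qed simp
  also have "\<dots> = 3 * int N + 1"
    by (simp add: card_nonzero)
  finally have "(\<Sum>D\<in>- {0}. (cubic_sum D) ^ 2) = 2 * int N * (int N + 1)"
    unfolding sum_nonzero_UNIV by (simp add: cubic_sum_0 algebra_simps power2_eq_square)
  moreover have "(\<Sum>D\<in>- {0}. (cubic_sum D) ^ 2) = (\<Sum>k<6 * (N div 6). (cubic_sum (g ^ k)) ^ 2)"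
    unfolding sum_powers using twelve_dvd_order by (intro sum.cong arg_cong[of _ _ lessThan]) presburger+
  moreover have "\<dots> = int (N div 6) * (\<Sum>k<6. (cubic_sum (g ^ k)) ^ 2)"
    by (rule sum_periodic) (simp add: cubic_sum_power_add_6)
  moreover have "int N = 6 * int (N div 6)"
    using twelve_dvd_order by presburger
  moreover have "(\<Sum>k<6. (cubic_sum (g ^ k)) ^ 2) =
      2 * ((cubic_sum 1) ^ 2 + (cubic_sum (g ^ 2)) ^ 2 + (cubic_sum (g ^ 4)) ^ 2)"
    using cubic_sum_power_add_3[of 0] cubic_sum_power_add_3[of 1] cubic_sum_power_add_3[of 2]
    by (simp add: eval_nat_numeral)
  ultimately have "int (N div 6) * (2 * ((cubic_sum 1) ^ 2 + (cubic_sum (g ^ 2)) ^ 2 + (cubic_sum (g ^ 4)) ^ 2)) =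
      int (N div 6) * (12 * (int N + 1))"
    by (simp add: algebra_simps)
  moreover have "int (N div 6) \<noteq> 0"
    using N_gt_1 twelve_dvd_order by simp presburger
  ultimately show ?thesis
    by (subst (asm) mult_cancel_left) simp
qed

text \<open>Nonzero cubes have three cube roots each, so modulo 3 only the term at
  \<open>x = 0\<close> survives.\<close>

lemma cubic_sum_mod_3: "\<exists>k. cubic_sum D = chi D + 3 * k"
proof -
  have "cubic_sum D = (\<Sum>x\<in>UNIV. cbrts x * chi (x + D))"
    unfolding cubic_sum_def using sum_cube[of "\<lambda>x. chi (x + D)"] .
  also have "\<dots> = chi D + (\<Sum>x\<in>- {0}. 3 * (of_bool (ind x mod 3 = 0) * chi (x + D)))"
    unfolding sum_nonzero_UNIV by (intro arg_cong2[of _ _ _ _ "(+)"] sum.cong) (auto simp: cbrts_eq)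
  finally show ?thesis
    unfolding sum_distrib_left[symmetric] by blast
qed

text \<open>\<open>chi\<close> is odd away from 0, and \<open>x ^ 3 + 1\<close> vanishes for exactly
  three \<open>x\<close>. This leaves \<open>N - 2\<close> odd terms, an even number.\<close>

lemma even_cubic_sum_1: "even (cubic_sum 1)"
proof -
  have *: "even (chi x - of_bool (x \<noteq> 0))" for x
    using chi_cases[of x] by (cases "x = 0") auto
  have "(\<Sum>x\<in>UNIV. of_bool (x ^ 3 + 1 \<noteq> (0::'a))) = (\<Sum>x\<in>UNIV. 1 - of_bool (x ^ 3 = (-1::'a)) :: int)"
    by (intro sum.cong) (auto simp: eq_neg_iff_add_eq_0)
  also have "\<dots> = int N + 1 - cbrts (- 1)"
    by (simp add: sum_subtractf card_field cbrts_def)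
  also have "cbrts (- 1) = 3"
    by (rule cbrts_minus_one)
  finally have "even (\<Sum>x\<in>UNIV. of_bool (x ^ 3 + 1 \<noteq> (0::'a)) :: int)"
    using twelve_dvd_order by presburger
  moreover have "even (\<Sum>x\<in>UNIV. chi (x ^ 3 + 1) - of_bool (x ^ 3 + 1 \<noteq> 0))"
    by (intro dvd_sum *)
  ultimately show ?thesis
    unfolding cubic_sum_def sum_subtractf by simp
qed

section \<open>Differences of sextic classes\<close>

lemma sum_reflect:
  fixes f :: "'a \<Rightarrow> int"
  shows "(\<Sum>a\<in>- {0, d}. f (d - a)) = (\<Sum>a\<in>- {0, d}. f a)"
  by (intro sum.reindex_bij_witness[of _ "\<lambda>a. d - a" "\<lambda>a. d - a"]) auto

lemma sum_pair_UNIV: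
  fixes f :: "'a \<Rightarrow> int"
  assumes "d \<noteq> 0"
  shows "(\<Sum>a\<in>UNIV. f a) = f 0 + f d + (\<Sum>a\<in>- {0, d}. f a)"
proof -
  have "(\<Sum>a\<in>insert 0 (insert d (- {0, d})). f a) = f 0 + (f d + (\<Sum>a\<in>- {0, d}. f a))"
    using assms by (subst sum.insert; auto)+
  moreover have "insert 0 (insert d (- {0, d})) = UNIV"
    by auto
  ultimately show ?thesis
    by simp
qed

text \<open>Complete the square: \<open>(2 * a - d) ^ 2 = d ^ 2 - 4 * w\<close>.\<close>

lemma card_product_fibre:
  "int (card {a. a * (d - a) = w}) = 1 + chi (d ^ 2 - 4 * w)"
proof -
  have "(2 * a - d) ^ 2 = d ^ 2 - 4 * w \<longleftrightarrow> a * (d - a) = w" for a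
  proof -
    have "(2 * a - d) ^ 2 - (d ^ 2 - 4 * w) = 4 * (w - a * (d - a))"
      by (simp add: algebra_simps power2_eq_square)
    then show ?thesis
      using four_nonzero by (metis eq_iff_diff_eq_0 mult_eq_0_iff)
  qed
  then have "{a. a * (d - a) = w} = (\<lambda>a. 2 * a - d) -` {y. y ^ 2 = d ^ 2 - 4 * w}"
    by simp
  also have "card \<dots> = card {y. y ^ 2 = d ^ 2 - 4 * w}"
  proof (rule card_vimage_inj)
    show "inj (\<lambda>a. 2 * a - d)"
      using two_nonzero by (intro injI) simp
    have "y = 2 * ((y + d) / 2) - d" for y
      using two_nonzero
      by (metis add_diff_cancel_right' nonzero_mult_div_cancel_left times_divide_eq_right)
    then show "{y. y ^ 2 = d ^ 2 - 4 * w} \<subseteq> range (\<lambda>a. 2 * a - d)"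
      by blast
  qed
  finally show ?thesis
    by (simp only: card_square_roots)
qed

text \<open>Group by the value of the product, with fibre sizes from
  \<open>card_product_fibre\<close>; the weight \<open>cbrts\<close> then turns a sum over values
  into a sum over their cube roots \<open>w\<close>. The weight \<open>f\<close> will be 1 or
  \<open>chi\<close>.\<close>

lemma sum_cbrts_product:
  fixes f :: "'a \<Rightarrow> int"
  assumes "d \<noteq> 0"
  shows "(\<Sum>a\<in>- {0, d}. f (a * (d - a)) * cbrts (a * (d - a))) =
    (\<Sum>w\<in>- {0}. f (w ^ 3) * (1 + chi (d ^ 2 - 4 * w ^ 3)))"
proof -
  have "(\<Sum>a\<in>- {0, d}. f (a * (d - a)) * cbrts (a * (d - a))) =
      (\<Sum>x\<in>UNIV. int (card {a\<in>- {0, d}. a * (d - a) = x}) * (f x * cbrts x))"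
    by (rule sum_fibre) simp
  also have "\<dots> = (\<Sum>x\<in>- {0}. (1 + chi (d ^ 2 - 4 * x)) * (f x * cbrts x))"
  proof -
    have "{a\<in>- {0, d}. a * (d - a) = 0} = {}"
      by auto
    moreover have "int (card {a\<in>- {0, d}. a * (d - a) = x}) = 1 + chi (d ^ 2 - 4 * x)" if "x \<noteq> 0" for x
    proof -
      have "{a\<in>- {0, d}. a * (d - a) = x} = {a. a * (d - a) = x}"
        using that by auto
      then show ?thesis
        by (simp add: card_product_fibre)
    qed
    ultimately show ?thesis
      unfolding sum_nonzero_UNIV by simp
  qed
  also have "\<dots> = (\<Sum>x\<in>UNIV. cbrts x * (if x = 0 then 0 else f x * (1 + chi (d ^ 2 - 4 * x))))"
    unfolding sum_nonzero_UNIV by (simp add: mult_ac)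
  also have "\<dots> = (\<Sum>w\<in>UNIV. if w ^ 3 = 0 then 0 else f (w ^ 3) * (1 + chi (d ^ 2 - 4 * w ^ 3)))"
    by (rule sum_cube[symmetric])
  also have "\<dots> = (\<Sum>w\<in>- {0}. f (w ^ 3) * (1 + chi (d ^ 2 - 4 * w ^ 3)))"
    unfolding sum_nonzero_UNIV by simp
  finally show ?thesis .
qed

text \<open>Parametrise by the ratio \<open>x = a / (d - a)\<close>. The product is \<open>x\<close>
  times a square, so a weight \<open>chi\<close> of the product becomes
  \<open>chi x\<close>.\<close>

lemma sum_ratio:
  fixes f :: "'a \<Rightarrow> 'a \<Rightarrow> int"
  assumes "d \<noteq> 0"
  shows "(\<Sum>a\<in>- {0, d}. f (a * (d - a)) (a / (d - a))) =
    (\<Sum>x\<in>- {0, -1}. f (x * (d / (1 + x)) ^ 2) x)"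
proof (rule sum.reindex_bij_witness[of _ "\<lambda>x. d * x / (1 + x)" "\<lambda>a. a / (d - a)"])
  fix a
  assume "a \<in> - {0, d}"
  then have a: "a \<noteq> 0" "d - a \<noteq> 0" by auto
  then have 1: "1 + a / (d - a) = d / (d - a)"
    by (simp add: field_simps)
  show "d * (a / (d - a)) / (1 + a / (d - a)) = a"
    unfolding 1 using a assms by (simp add: field_simps)
  have "1 + a / (d - a) \<noteq> 0"
    unfolding 1 using a assms by simp
  then show "a / (d - a) \<in> - {0, - 1}"
    using a by (auto simp: add_eq_0_iff)
  have "a / (d - a) * (d / (1 + a / (d - a))) ^ 2 = a * (d - a)"
    unfolding 1 using a assms by (simp add: field_simps power2_eq_square)
  then show "f (a / (d - a) * (d / (1 + a / (d - a))) ^ 2) (a / (d - a)) =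
      f (a * (d - a)) (a / (d - a))"
    by simp
next
  fix x :: 'a
  assume "x \<in> - {0, -1}"
  then have x: "x \<noteq> 0" "1 + x \<noteq> 0"
    by (auto simp: add_eq_0_iff)
  then have 1: "d - d * x / (1 + x) = d / (1 + x)"
    by (simp add: field_simps)
  show "d * x / (1 + x) / (d - d * x / (1 + x)) = x"
    unfolding 1 using x assms by simp
  have "d - d * x / (1 + x) \<noteq> 0"
    unfolding 1 using x assms by simp
  then show "d * x / (1 + x) \<in> - {0, d}"
    using x assms by auto
qed

lemma sum_chi_product:
  assumes "d \<noteq> 0"
  shows "(\<Sum>a\<in>- {0, d}. chi (a * (d - a))) = -1"
proof -
  have *: "chi (a * (d - a)) = chi ((a + 0) * (a + - d))" for a
    using chi_minus[of "(a + 0) * (a + - d)"] by (simp add: algebra_simps)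
  have "(\<Sum>a\<in>UNIV. chi (a * (d - a))) = -1"
    unfolding * sum_chi_quadratic using assms by simp
  then show ?thesis
    using sum_pair_UNIV[OF assms, of "\<lambda>a. chi (a * (d - a))"] by simp
qed

text \<open>\<open>cbrts_mult\<close> summed with a weight; the reflection of \<open>a\<close> to
  \<open>d - a\<close> merges the two single terms.\<close>

lemma sum_cbrts_pair:
  fixes f :: "'a \<Rightarrow> int"
  assumes "\<And>x y. f (x * y) = f (y * x)"
  shows "(\<Sum>a\<in>- {0, d}. f (a * (d - a)) * (cbrts a * cbrts (d - a))) =
    2 * (\<Sum>a\<in>- {0, d}. f (a * (d - a)) * cbrts a) +
    (\<Sum>a\<in>- {0, d}. f (a * (d - a)) * cbrts (a * (d - a))) +
    (\<Sum>a\<in>- {0, d}. f (a * (d - a)) * cbrts (a / (d - a))) -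
    3 * (\<Sum>a\<in>- {0, d}. f (a * (d - a)))"
proof -
  have "(\<Sum>a\<in>- {0, d}. f (a * (d - a)) * cbrts (d - a)) = (\<Sum>a\<in>- {0, d}. f (a * (d - a)) * cbrts a)"
    using sum_reflect[of "\<lambda>a. f (a * (d - a)) * cbrts a" d] assms by simp
  moreover have "(\<Sum>a\<in>- {0, d}. f (a * (d - a)) * (cbrts a * cbrts (d - a))) =
     (\<Sum>a\<in>- {0, d}. f (a * (d - a)) * cbrts a + f (a * (d - a)) * cbrts (d - a) +
       f (a * (d - a)) * cbrts (a * (d - a)) + f (a * (d - a)) * cbrts (a / (d - a)) -
       3 * f (a * (d - a)))"
  proof (intro sum.cong refl)
    fix a
    assume "a \<in> - {0, d}"
    then have "cbrts a * cbrts (d - a) =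
        cbrts a + cbrts (d - a) + cbrts (a * (d - a)) + cbrts (a / (d - a)) - 3"
      by (intro cbrts_mult) auto
    moreover have "F * (A + B + C + D - 3) = F * A + F * B + F * C + F * D - 3 * F" for F A B C D :: int
      by (simp add: algebra_simps)
    ultimately show "f (a * (d - a)) * (cbrts a * cbrts (d - a)) =
        f (a * (d - a)) * cbrts a + f (a * (d - a)) * cbrts (d - a) +
        f (a * (d - a)) * cbrts (a * (d - a)) + f (a * (d - a)) * cbrts (a / (d - a)) -
        3 * f (a * (d - a))"
      by (simp only:)
  qed
  ultimately show ?thesis
    unfolding sum.distrib sum_subtractf by (simp flip: sum_distrib_left)
qed

text \<open>The left side counts the solutions of u^3 + v^3 = d with u and v nonzero.\<close>

lemma sum_fermat_cubic:
  assumes "d \<noteq> 0"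
  shows "(\<Sum>a\<in>- {0, d}. cbrts a * cbrts (d - a)) =
    int N - 1 + cubic_sum (16 * d ^ 2) - 2 * cbrts d"
proof -
  have card_pair: "card (- {0, d}) = N - 1"
    using assms by (simp add: Compl_eq_Diff_UNIV card_Diff_subset card_field)
  have 1: "(\<Sum>a\<in>- {0, d}. cbrts a) = int N - cbrts d"
    using sum_pair_UNIV[OF assms, of cbrts] sum_cbrts by simp
  have "(\<Sum>a\<in>- {0, d}. cbrts (a * (d - a))) = (\<Sum>w\<in>- {0}. 1 + chi (d ^ 2 - 4 * w ^ 3))"
    using sum_cbrts_product[OF assms, of "\<lambda>_. 1"] by simp
  also have "\<dots> = int N + (\<Sum>w\<in>- {0}. chi (d ^ 2 - 4 * w ^ 3))"
    by (simp add: sum.distrib card_nonzero)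
  also have "(\<Sum>w\<in>- {0}. chi (d ^ 2 - 4 * w ^ 3)) = (\<Sum>w\<in>UNIV. chi (d ^ 2 - 4 * w ^ 3)) - 1"
    using sum_nonzero_UNIV[of "\<lambda>w. chi (d ^ 2 - 4 * w ^ 3)"] assms
    by (simp add: chi_powers chi_square)
  \<comment> \<open>The factor \<open>4 ^ 2\<close> makes the cubic monic in
    \<open>- 4 * w\<close>.\<close>
  also have "(\<Sum>w\<in>UNIV. chi (d ^ 2 - 4 * w ^ 3)) = (\<Sum>w\<in>UNIV. chi ((- 4 * w) ^ 3 + 16 * d ^ 2))"
  proof (intro sum.cong refl)
    fix w :: 'a
    have "(- 4 * w) ^ 3 + 16 * d ^ 2 = 4 ^ 2 * (d ^ 2 - 4 * w ^ 3)"
      by (simp add: algebra_simps power2_eq_square power3_eq_cube)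
    then show "chi (d ^ 2 - 4 * w ^ 3) = chi ((- 4 * w) ^ 3 + 16 * d ^ 2)"
      using four_nonzero by (metis chi_square_mult)
  qed
  also have "\<dots> = cubic_sum (16 * d ^ 2)"
    unfolding cubic_sum_def using sum_scale[of "- 4" "\<lambda>x. chi (x ^ 3 + 16 * d ^ 2)"] four_nonzero
    by simp
  finally have 2: "(\<Sum>a\<in>- {0, d}. cbrts (a * (d - a))) = int N - 1 + cubic_sum (16 * d ^ 2)"
    by simp
  have "(\<Sum>a\<in>- {0, d}. cbrts (a / (d - a))) = (\<Sum>x\<in>- {0, - 1}. cbrts x)"
    using sum_ratio[OF assms, of "\<lambda>_. cbrts"] .
  also have "\<dots> = int N - 3"
    using sum_pair_UNIV[of "- 1" cbrts] sum_cbrts cbrts_minus_one by simp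
  finally have 3: "(\<Sum>a\<in>- {0, d}. cbrts (a / (d - a))) = int N - 3" .
  show ?thesis
    using sum_cbrts_pair[of "\<lambda>_. 1" d] N_gt_1 by (simp add: 1 2 3 card_pair)
qed

text \<open>The single terms and the product term both reduce to \<open>sum_chi_cube_twist\<close>,
  with parameters \<open>d\<close>, \<open>-1\<close> and \<open>d ^ 2\<close>, \<open>-4\<close>.
  In the ratio term the square drops out of \<open>chi\<close>, leaving the vanishing sum of
  \<open>chi (u ^ 3)\<close> up to its value at -1.\<close>

lemma sum_fermat_cubic_twist:
  assumes "d \<noteq> 0"
  shows "(\<Sum>a\<in>- {0, d}. chi (a * (d - a)) * (cbrts a * cbrts (d - a))) =
    2 * cubic_sum (d ^ 2) + cubic_sum (4 * d ^ 4) - 3"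
proof -
  have "(\<Sum>a\<in>- {0, d}. chi (a * (d - a)) * cbrts a) = (\<Sum>a\<in>UNIV. cbrts a * chi (a * (d - a)))"
    using sum_pair_UNIV[OF assms, of "\<lambda>a. cbrts a * chi (a * (d - a))"] by (simp add: mult_ac)
  also have "\<dots> = (\<Sum>u\<in>UNIV. chi (u ^ 3 * (d - u ^ 3)))"
    by (rule sum_cube[symmetric])
  also have "\<dots> = (\<Sum>u\<in>- {0}. chi u * chi (d + (- 1) * u ^ 3))"
    unfolding sum_nonzero_UNIV by (simp add: chi_mult chi_cube)
  also have "\<dots> = cubic_sum (d ^ 2) - 1"
    unfolding sum_chi_cube_twist[OF assms] using cubic_sum_minus[of "d ^ 2"] by simp
  finally have 1: "(\<Sum>a\<in>- {0, d}. chi (a * (d - a)) * cbrts a) = cubic_sum (d ^ 2) - 1" .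
  have "(\<Sum>a\<in>- {0, d}. chi (a * (d - a)) * cbrts (a * (d - a))) =
      (\<Sum>w\<in>- {0}. chi w + chi w * chi (d ^ 2 + (- 4) * w ^ 3))"
    unfolding sum_cbrts_product[OF assms] by (simp add: chi_cube algebra_simps)
  also have "\<dots> = cubic_sum ((d ^ 2) ^ 2 * (- 4)) - chi (- 4)"
    unfolding sum.distrib sum_chi_nonzero using sum_chi_cube_twist[of "d ^ 2" "- 4"] assms by simp
  also have "(d ^ 2) ^ 2 * (- 4) = - (4 * d ^ 4)"
    by (simp flip: power_mult)
  also have "chi (- 4) = 1"
    using chi_square_mult[of 2 1] two_nonzero by simp
  finally have 2: "(\<Sum>a\<in>- {0, d}. chi (a * (d - a)) * cbrts (a * (d - a))) = cubic_sum (4 * d ^ 4) - 1"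
    by (simp add: cubic_sum_minus)
  have "(\<Sum>a\<in>- {0, d}. chi (a * (d - a)) * cbrts (a / (d - a))) =
      (\<Sum>x\<in>- {0, - 1}. chi (x * (d / (1 + x)) ^ 2) * cbrts x)"
    using sum_ratio[OF assms, of "\<lambda>y x. chi y * cbrts x"] .
  also have "\<dots> = (\<Sum>x\<in>- {0, - 1}. cbrts x * chi x)"
    using assms by (intro sum.cong) (auto simp: chi_mult chi_powers chi_square add_eq_0_iff)
  also have "\<dots> = (\<Sum>x\<in>UNIV. cbrts x * chi x) - 3"
    using sum_pair_UNIV[of "- 1" "\<lambda>x. cbrts x * chi x"] by (simp add: cbrts_minus_one)
  also have "(\<Sum>x\<in>UNIV. cbrts x * chi x) = 0"
    using sum_cube[of chi] by (simp add: chi_cube sum_chi)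
  finally have 3: "(\<Sum>a\<in>- {0, d}. chi (a * (d - a)) * cbrts (a / (d - a))) = - 3"
    by simp
  show ?thesis
    unfolding sum_cbrts_pair[of chi d, OF arg_cong[of _ _ chi, OF mult.commute]]
    using sum_chi_product[OF assms] by (simp add: 1 2 3)
qed

text \<open>Both arguments are nonzero on this range, so each factor is 0 or 3. This divisibility
  later forces 2 to be a cube.\<close>

lemma nine_dvd_sum_fermat_cubic: "9 dvd (\<Sum>a\<in>- {0, d}. cbrts a * cbrts (d - a))"
proof (intro dvd_sum)
  fix a
  assume "a \<in> - {0, d}"
  then show "9 dvd cbrts a * cbrts (d - a)"
    by (auto simp: cbrts_eq)
qed

text \<open>The subgroup of sixth powers; \<open>cubic_nonsquares\<close> is its coset of
  \<open>g ^ 3\<close>.\<close>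

definition sextic_residues :: "'a set" where
  "sextic_residues = {x. x \<noteq> 0 \<and> ind x mod 6 = 0}"

definition cubic_nonsquares :: "'a set" where
  "cubic_nonsquares = {x. x \<noteq> 0 \<and> ind x mod 6 = 3}"

lemma indicator_sextic_residues:
  assumes "x \<noteq> 0"
  shows "6 * of_bool (x \<in> sextic_residues) = cbrts x * (1 + chi x)"
proof -
  have "ind x mod 6 = 0 \<longleftrightarrow> ind x mod 3 = 0 \<and> ind x mod 2 = 0"
    by presburger
  then show ?thesis
    using assms by (simp add: sextic_residues_def cbrts_eq chi_def minus_one_power_mod_2)
qed

lemma indicator_cubic_nonsquares:
  assumes "x \<noteq> 0"
  shows "6 * of_bool (x \<in> cubic_nonsquares) = cbrts x * (1 - chi x)"
proof -
  have "ind x mod 6 = 3 \<longleftrightarrow> ind x mod 3 = 0 \<and> ind x mod 2 \<noteq> 0"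
    by presburger
  then show ?thesis
    using assms by (simp add: cubic_nonsquares_def cbrts_eq chi_def minus_one_power_mod_2)
qed

lemma sum_cbrts_chi: "(\<Sum>x\<in>- {0}. cbrts x * chi x) = 0"
  using sum_cube[of chi] sum_nonzero_UNIV[of "\<lambda>x. cbrts x * chi x"] by (simp add: chi_cube sum_chi)

lemma sum_cbrts_nonzero: "(\<Sum>x\<in>- {0}. cbrts x) = int N"
  using sum_cbrts sum_nonzero_UNIV[of cbrts] by simp

lemma card_eq_sum_nonzero:
  assumes "0 \<notin> A"
  shows "int (card A) = (\<Sum>x\<in>- {0::'a}. of_bool (x \<in> A))"
proof -
  have "- {0} \<inter> A = A"
    using assms by auto
  then show ?thesis
    by (simp add: Int_def)
qed

lemma card_sextic_residues: "6 * card sextic_residues = N"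
proof -
  have "6 * int (card sextic_residues) = (\<Sum>x\<in>- {0}. 6 * of_bool (x \<in> sextic_residues))"
    by (subst card_eq_sum_nonzero) (simp_all add: sextic_residues_def sum_distrib_left)
  also have "\<dots> = (\<Sum>x\<in>- {0}. cbrts x + cbrts x * chi x)"
    by (intro sum.cong refl) (simp add: indicator_sextic_residues algebra_simps del: of_bool_eq)
  also have "\<dots> = int N"
    by (simp add: sum.distrib sum_cbrts_chi sum_cbrts_nonzero)
  finally show ?thesis
    by linarith
qed

lemma card_cubic_nonsquares: "6 * card cubic_nonsquares = N"
proof -
  have "6 * int (card cubic_nonsquares) = (\<Sum>x\<in>- {0}. 6 * of_bool (x \<in> cubic_nonsquares))"
    by (subst card_eq_sum_nonzero) (simp_all add: cubic_nonsquares_def sum_distrib_left)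
  also have "\<dots> = (\<Sum>x\<in>- {0}. cbrts x - cbrts x * chi x)"
    by (intro sum.cong refl) (simp add: indicator_cubic_nonsquares algebra_simps del: of_bool_eq)
  also have "\<dots> = int N"
    by (simp add: sum_subtractf sum_cbrts_chi sum_cbrts_nonzero)
  finally show ?thesis
    by linarith
qed

lemma card_differences:
  assumes "d \<noteq> 0"
  shows "36 * int (card {(x, y) \<in> sextic_residues \<times> cubic_nonsquares. x - y = d}) =
    int N + 2 + cubic_sum (16 * d ^ 2) - 2 * cubic_sum (d ^ 2) - cubic_sum (4 * d ^ 4) - 2 * cbrts d"
proof -
  let ?R = "{a \<in> - {0, d}. a \<in> sextic_residues \<and> a - d \<in> cubic_nonsquares}"
  have "{(x, y) \<in> sextic_residues \<times> cubic_nonsquares. x - y = d} = (\<lambda>a. (a, a - d)) ` ?R"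
  proof (intro equalityI subsetI)
    fix z
    assume "z \<in> {(x, y) \<in> sextic_residues \<times> cubic_nonsquares. x - y = d}"
    then obtain x y where z: "z = (x, y)" "x \<in> sextic_residues" "y \<in> cubic_nonsquares" "x - y = d"
      by blast
    moreover have "x - d = y"
      using z(4) by auto
    moreover have "x \<noteq> 0" "y \<noteq> 0"
      using z(2,3) by (simp_all add: sextic_residues_def cubic_nonsquares_def)
    ultimately show "z \<in> (\<lambda>a. (a, a - d)) ` ?R"
      by (intro image_eqI[of _ _ x]) auto
  qed auto
  then have "card {(x, y) \<in> sextic_residues \<times> cubic_nonsquares. x - y = d} = card ?R"
    by (simp only:) (rule card_image, simp add: inj_on_def)
  then have "36 * int (card {(x, y) \<in> sextic_residues \<times> cubic_nonsquares. x - y = d}) = 36 * int (card ?R)"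
    by (simp only:)
  also have "\<dots> = (\<Sum>a\<in>- {0, d}. 36 * of_bool (a \<in> sextic_residues \<and> a - d \<in> cubic_nonsquares))"
    by (simp add: Int_def flip: sum_distrib_left)
  also have "\<dots> = (\<Sum>a\<in>- {0, d}. (cbrts a * (1 + chi a)) * (cbrts (d - a) * (1 - chi (d - a))))"
  proof (intro sum.cong refl)
    fix a
    assume "a \<in> - {0, d}"
    then have a: "a \<noteq> 0" "a - d \<noteq> 0"
      by auto
    have "(6 * of_bool (a \<in> sextic_residues)) * (6 * of_bool (a - d \<in> cubic_nonsquares)) =
        (cbrts a * (1 + chi a)) * (cbrts (a - d) * (1 - chi (a - d)))"
      by (simp only: indicator_sextic_residues[OF a(1)] indicator_cubic_nonsquares[OF a(2)])
    then show "36 * of_bool (a \<in> sextic_residues \<and> a - d \<in> cubic_nonsquares) =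
        (cbrts a * (1 + chi a)) * (cbrts (d - a) * (1 - chi (d - a)))"
      using cbrts_minus[of "d - a"] chi_minus[of "d - a"] by (simp add: of_bool_conj)
  qed
  \<comment> \<open>The two terms linear in \<open>chi\<close> are exchanged by the reflection of
    \<open>a\<close> to \<open>d - a\<close>, so they cancel; \<open>d - (d - a)\<close> is left
    unsimplified to exhibit this.\<close>
  also have "\<dots> = (\<Sum>a\<in>- {0, d}. cbrts a * cbrts (d - a) -
      chi (a * (d - a)) * (cbrts a * cbrts (d - a)) + chi a * (cbrts a * cbrts (d - a)) -
      chi (d - a) * (cbrts (d - a) * cbrts (d - (d - a))))"
    by (intro sum.cong refl) (simp only: chi_mult, simp add: algebra_simps)
  also have "\<dots> = (\<Sum>a\<in>- {0, d}. cbrts a * cbrts (d - a)) -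
      (\<Sum>a\<in>- {0, d}. chi (a * (d - a)) * (cbrts a * cbrts (d - a)))"
    unfolding sum.distrib sum_subtractf
    using sum_reflect[of "\<lambda>a. chi a * (cbrts a * cbrts (d - a))" d] by simp
  finally show ?thesis
    unfolding sum_fermat_cubic[OF assms] sum_fermat_cubic_twist[OF assms] by simp
qed

section \<open>Fields of prime order 1 + 108 t^2\<close>

context
  fixes t :: int
  assumes prime_card_field: "prime (int N + 1)"
    and N_eq: "int N = 108 * t ^ 2"
begin

text \<open>The moments and congruences pin the values down through the unique representation of the
  prime by a^2 + 3 b^2. The sign of \<open>s\<close> stays open, as it depends on the
  generator.\<close>

lemma cubic_sum_values:
  obtains s where "cubic_sum 1 = -2" "cubic_sum (g ^ 2) = 1 + 18 * s" "cubic_sum (g ^ 4) = 1 - 18 * s"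
proof -
  obtain k0 k1 k2 where k: "cubic_sum 1 = 1 + 3 * k0" "cubic_sum (g ^ 2) = 1 + 3 * k1"
      "cubic_sum (g ^ 4) = 1 + 3 * k2"
    using cubic_sum_mod_3[of 1] cubic_sum_mod_3[of "g ^ 2"] cubic_sum_mod_3[of "g ^ 4"]
    by (auto simp: chi_power)
  obtain a where a: "cubic_sum 1 = 2 * a"
    using even_cubic_sum_1 by (elim evenE)
  \<comment> \<open>The division is exact: the first moment reads
    \<open>2 * a + 2 + 3 * (k1 + k2) = 0\<close>, so \<open>k1\<close> and \<open>k2\<close> have
    the same parity.\<close>
  define b where "b = (k1 - k2) div 2"
  have "2 * a + (1 + 3 * k1) + (1 + 3 * k2) = 0"
    using cubic_sum_first_moment by (simp add: a k)
  then have s1: "cubic_sum (g ^ 2) = - a + 3 * b" and s2: "cubic_sum (g ^ 4) = - a - 3 * b"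
    unfolding b_def k by presburger+
  have "int N + 1 = a ^ 2 + 3 * b ^ 2"
    using cubic_sum_second_moment unfolding a s1 s2 by (simp add: algebra_simps power2_eq_square)
  moreover have N1: "int N + 1 = 1 ^ 2 + 3 * (6 * t) ^ 2"
    using N_eq by (simp add: power_mult_distrib)
  ultimately have "a ^ 2 = 1 ^ 2"
    using norm_form_unique[OF prime_card_field] by blast
  then have "a = 1 \<or> a = -1"
    by (simp add: power2_eq_1_iff)
  \<comment> \<open>\<open>2 * a\<close> is 1 modulo 3, so \<open>a\<close> is -1 modulo 3.\<close>
  moreover have "a \<noteq> 1"
    using a k(1) by presburger
  ultimately have "a = -1"
    by blast
  then have "b ^ 2 = (6 * t) ^ 2"
    using \<open>int N + 1 = a ^ 2 + 3 * b ^ 2\<close> N1 by simp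
  then obtain s where "b = 6 * s"
    by (metis mult_minus_right power2_eq_iff)
  then show ?thesis
    using that[of s] a s1 s2 \<open>a = -1\<close> by simp
qed

lemma cubic_sum_power_mod_6: "cubic_sum (g ^ k) = cubic_sum (g ^ (k mod 6))"
proof -
  have "cubic_sum (g ^ (i + 6 * j)) = cubic_sum (g ^ i)" for i j
  proof (induction j)
    case (Suc j)
    then show ?case
      using cubic_sum_power_add_6[of "i + 6 * j"] by (simp add: add_ac)
  qed simp
  from this[of "k mod 6" "k div 6"] show ?thesis
    by simp
qed

text \<open>Otherwise 16 lies in the class of \<open>g ^ 2\<close> or \<open>g ^ 4\<close>, and the
  sum of \<open>cbrts a * cbrts (1 - a)\<close> would be -6 modulo 9, although 9 divides it.\<close>

lemma two_is_cube: "ind 2 mod 3 = 0"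
proof (rule ccontr)
  assume "ind 2 mod 3 \<noteq> 0"
  then have m: "4 * ind 2 mod 6 = 2 \<or> 4 * ind 2 mod 6 = 4"
    by presburger
  have "(16::'a) = 2 ^ 4"
    by simp
  also have "\<dots> = g ^ (4 * ind 2)"
    using power_ind[OF two_nonzero] by (metis mult.commute power_mult)
  finally have "cubic_sum 16 = cubic_sum (g ^ (4 * ind 2 mod 6))"
    using cubic_sum_power_mod_6 by simp
  moreover obtain s where "cubic_sum (g ^ 2) = 1 + 18 * s" "cubic_sum (g ^ 4) = 1 - 18 * s"
    by (rule cubic_sum_values)
  \<comment> \<open>The new \<open>s\<close> absorbs the sign that distinguishes the two
    classes.\<close>
  ultimately obtain s where s: "cubic_sum 16 = 1 + 18 * s"
    using m by (metis diff_conv_add_uminus mult_minus_right)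
  have "9 dvd int N - 1 + cubic_sum 16 - 2 * cbrts 1"
    using nine_dvd_sum_fermat_cubic[of 1] sum_fermat_cubic[of 1] by simp
  moreover have "cbrts 1 = 3"
    using cbrts_minus[of 1] cbrts_minus_one by simp
  ultimately have "9 dvd 108 * t ^ 2 + 18 * s - 6"
    by (simp add: s N_eq)
  then show False
    by presburger
qed

lemma card_differences_eq:
  assumes "d \<noteq> 0"
  shows "36 * card {(x, y) \<in> sextic_residues \<times> cubic_nonsquares. x - y = d} = N"
proof -
  define i j where "i = ind 2" and "j = ind d"
  have d: "d = g ^ j" and two: "2 = g ^ i"
    using assms two_nonzero power_ind by (simp_all add: i_def j_def)
  have "16 * d ^ 2 = 2 ^ 4 * d ^ 2" "4 * d ^ 4 = 2 ^ 2 * d ^ 4"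
    by simp_all
  then have exps: "16 * d ^ 2 = g ^ (i * 4 + j * 2)" "4 * d ^ 4 = g ^ (i * 2 + j * 4)"
      "d ^ 2 = g ^ (j * 2)"
    unfolding d two by (simp_all add: power_add power_mult)
  have i: "i mod 3 = 0"
    using two_is_cube by (simp add: i_def)
  have c: "cbrts d = (if j mod 3 = 0 then 3 else 0)"
    using assms by (simp add: cbrts_eq j_def)
  obtain s where s: "cubic_sum 1 = -2" "cubic_sum (g ^ 2) = 1 + 18 * s" "cubic_sum (g ^ 4) = 1 - 18 * s"
    by (rule cubic_sum_values)
  \<comment> \<open>As 2 is a cube, 16 and 4 are sixth powers and do not affect the class.\<close>
  have "(i * 4 + j * 2) mod 6 = (j * 2) mod 6" "(i * 2 + j * 4) mod 6 = (j * 4) mod 6"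
    using i by presburger+
  then have "cubic_sum (16 * d ^ 2) = cubic_sum (g ^ (j * 2 mod 6))"
      "cubic_sum (4 * d ^ 4) = cubic_sum (g ^ (j * 4 mod 6))"
    unfolding exps(1,2) using cubic_sum_power_mod_6 by metis+
  moreover have "cubic_sum (d ^ 2) = cubic_sum (g ^ (j * 2 mod 6))"
    unfolding exps(3) by (rule cubic_sum_power_mod_6)
  ultimately have "36 * int (card {(x, y) \<in> sextic_residues \<times> cubic_nonsquares. x - y = d}) =
      int N + 2 - cubic_sum (g ^ (j * 2 mod 6)) - cubic_sum (g ^ (j * 4 mod 6)) - 2 * cbrts d"
    unfolding card_differences[OF assms] by simp
  also have "\<dots> = int N"
  proof -
    \<comment> \<open>If \<open>d\<close> is a cube, both cubic sums are -2 and
      \<open>cbrts d\<close> is 3; otherwise they are \<open>1 + 18 * s\<close> and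
      \<open>1 - 18 * s\<close> in some order, and \<open>cbrts d\<close> is 0. In both cases the
      correction to \<open>int N\<close> vanishes.\<close>
    have "j mod 3 = 0 \<and> j * 2 mod 6 = 0 \<and> j * 4 mod 6 = 0 \<or>
        j mod 3 \<noteq> 0 \<and> j * 2 mod 6 = 2 \<and> j * 4 mod 6 = 4 \<or>
        j mod 3 \<noteq> 0 \<and> j * 2 mod 6 = 4 \<and> j * 4 mod 6 = 2"
      by presburger
    then show ?thesis
      by (elim disjE conjE) (simp_all add: c s)
  qed
  finally show ?thesis
    by linarith
qed

end

end

section \<open>Prime fields\<close>

text \<open>A primitive root modulo the prime is mapped into the field; its powers are distinct and
  nonzero, and counting shows that they exhaust the nonzero elements.\<close>

lemma generator_mod_ring:
  obtains g :: "'n::prime_card mod_ring"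
    where "bij_betw (\<lambda>i. g ^ i) {..<CARD('n) - 1} (- {0})"
proof -
  have p: "prime CARD('n)"
    by (rule prime_card)
  obtain r where r: "residue_primroot CARD('n) r"
    using prime_primitive_root_exists[OF prime_gt_1_nat[OF p] p] by blast
  have bij: "bij_betw (\<lambda>i. r ^ i mod CARD('n)) {..<CARD('n) - 1} (totatives CARD('n))"
    using residue_primroot_is_generator[OF prime_gt_1_nat[OF p] r] totient_prime[OF p] by simp
  let ?f = "\<lambda>i. (of_nat r :: 'n mod_ring) ^ i"
  have inj: "inj_on ?f {..<CARD('n) - 1}"
  proof (rule inj_onI)
    fix i j
    assume "i \<in> {..<CARD('n) - 1}" "j \<in> {..<CARD('n) - 1}" "?f i = ?f j"
    moreover from this(3) have "r ^ i mod CARD('n) = r ^ j mod CARD('n)"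
      by (metis cong_def of_nat_eq_iff_cong_CHAR of_nat_power semiring_char_mod_ring)
    ultimately show "i = j"
      using bij_betw_imp_inj_on[OF bij] by (auto dest: inj_onD)
  qed
  have "coprime CARD('n) r"
    using r by (simp add: residue_primroot_def)
  then have "\<not> CARD('n) dvd r"
    using p by (auto simp: prime_nat_iff coprime_absorb_left)
  then have "(of_nat r :: 'n mod_ring) \<noteq> 0"
    using of_nat_0_mod_ring_dvd by blast
  then have "?f ` {..<CARD('n) - 1} \<subseteq> - {0}"
    by auto
  moreover have "card (- {0 :: 'n mod_ring}) \<le> card (?f ` {..<CARD('n) - 1})"
    unfolding card_image[OF inj] by (simp add: Compl_eq_Diff_UNIV)
  ultimately have "?f ` {..<CARD('n) - 1} = - {0}"
    by (intro card_seteq) auto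
  then show ?thesis
    using that[of "of_nat r"] inj by (simp add: bij_betw_def)
qed

lemma SEDF_exists_mod_ring:
  assumes card: "int CARD('n::prime_card) = 1 + 108 * t ^ 2"
  shows "SEDF_exists CARD('n) 2 ((CARD('n) - 1) div 6) ((CARD('n) - 1) div 36)"
proof -
  define N where "N = CARD('n) - 1"
  have N: "CARD('n) = N + 1"
    using prime_gt_0_nat[OF prime_card[where 'a = 'n]] by (simp add: N_def)
  then have N_eq: "int N = 108 * t ^ 2"
    using card by simp
  obtain g :: "'n mod_ring" where g: "bij_betw (\<lambda>i. g ^ i) {..<N} (- {0})"
    unfolding N_def by (rule generator_mod_ring)
  interpret cyclic_field g N
  proof
    have "int 12 dvd int N"
      unfolding N_eq by (intro dvd_mult2) simp
    then show "12 dvd N"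
      by (simp only: of_nat_dvd_iff)
  qed (use g N in simp_all)
  have "prime (int N + 1)"
    using prime_card_int[where 'a = 'n] N by (simp add: add.commute)
  note differences = card_differences_eq[OF this N_eq]
  have "SEDF_exists CARD('n mod_ring) 2 (N div 6) (N div 36)"
  proof (rule SEDF_exists_pair[of _ _ sextic_residues cubic_nonsquares])
    \<comment> \<open>Read off from the count of differences at \<open>d = 1\<close>.\<close>
    have "36 dvd N"
      by (rule dvdI[OF differences[OF one_neq_zero, symmetric]])
    then show "N div 6 > 0" "N div 36 > 0"
      using N_gt_1 by presburger+
    show "card sextic_residues = N div 6" "card cubic_nonsquares = N div 6"
      using card_sextic_residues card_cubic_nonsquares by simp_all
    show "sextic_residues \<inter> cubic_nonsquares = {}"
      by (auto simp: sextic_residues_def cubic_nonsquares_def)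
    show "card {(x, y) \<in> sextic_residues \<times> cubic_nonsquares. x - y = d} = N div 36" if "d \<noteq> 0" for d
      using differences[OF that] by simp
  qed
  then show ?thesis
    by (simp add: N_def)
qed

text \<open>The prime field is needed as a type, but a type cannot depend on the variable \<open>p\<close>. We therefore
  choose one prime that is a counterexample to the theorem if there are any, and build the field
  for this prime only.\<close>

definition target_prime :: "nat \<Rightarrow> bool" where
  "target_prime p \<longleftrightarrow> prime p \<and> (\<exists>t::int. int p = 1 + 108 * t ^ 2)"

definition critical_prime :: nat where
  "critical_prime = (SOME p. target_prime p \<and>
     ((\<exists>r. target_prime r \<and> \<not> SEDF_exists r 2 ((r - 1) div 6) ((r - 1) div 36)) \<longrightarrow>
      \<not> SEDF_exists p 2 ((p - 1) div 6) ((p - 1) div 36)))"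

text \<open>The case \<open>t = 1\<close>. It guarantees that \<open>critical_prime\<close> is a
  prime of the required form even when there is no counterexample.\<close>

lemma target_prime_109: "target_prime 109"
proof -
  have "prime (109::nat)"
    by simp
  moreover have "int 109 = 1 + 108 * 1 ^ 2"
    by simp
  ultimately show ?thesis
    unfolding target_prime_def by blast
qed

lemma critical_prime:
  "target_prime critical_prime"
  "target_prime r \<Longrightarrow> \<not> SEDF_exists r 2 ((r - 1) div 6) ((r - 1) div 36) \<Longrightarrow>
     \<not> SEDF_exists critical_prime 2 ((critical_prime - 1) div 6) ((critical_prime - 1) div 36)"
proof -
  let ?bad = "\<lambda>r. \<not> SEDF_exists r 2 ((r - 1) div 6) ((r - 1) div 36)"
  \<comment> \<open>The witness is a counterexample if one exists, and 109 otherwise.\<close>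
  have "\<exists>p. target_prime p \<and> ((\<exists>r. target_prime r \<and> ?bad r) \<longrightarrow> ?bad p)"
    using target_prime_109 by blast
  from someI_ex[OF this] have "target_prime critical_prime \<and>
    ((\<exists>r. target_prime r \<and> ?bad r) \<longrightarrow> ?bad critical_prime)"
    unfolding critical_prime_def .
  then show "target_prime critical_prime"
    "target_prime r \<Longrightarrow> ?bad r \<Longrightarrow> ?bad critical_prime" by blast+
qed

typedef prime_index = "{..<critical_prime}"
proof -
  have "critical_prime > 0"
    using critical_prime(1) by (simp add: target_prime_def prime_gt_0_nat)
  then show ?thesis by blast
qed

lemma card_prime_index: "CARD(prime_index) = critical_prime"
  using type_definition.card[OF type_definition_prime_index] by simp

instance prime_index :: prime_card
  by standard (use critical_prime(1) in \<open>simp add: card_prime_index target_prime_def\<close>)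

theorem theorem4p6:
  fixes p :: nat
  assumes "prime p"
    and "\<exists>t::int. int p = 1 + 108 * t ^ 2"
  shows "SEDF_exists p 2 ((p - 1) div 6) ((p - 1) div 36)"
proof (rule ccontr)
  assume "\<not> SEDF_exists p 2 ((p - 1) div 6) ((p - 1) div 36)"
  moreover have "target_prime p"
    using assms by (simp add: target_prime_def)
  ultimately have "\<not> SEDF_exists critical_prime 2 ((critical_prime - 1) div 6) ((critical_prime - 1) div 36)"
    using critical_prime(2) by blast
  moreover obtain t :: int where "int critical_prime = 1 + 108 * t ^ 2"
    using critical_prime(1) by (auto simp: target_prime_def)
  ultimately show False
    using SEDF_exists_mod_ring[where 'n = prime_index and t = t, unfolded card_prime_index] by blast
qed

end
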